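(* Let $\preceq$ be an order on $\mathbb{T}$ compatible with arithmetic operations, satisfying the weak law of trichotomy (WLT) and having positive $0$-symmetric numbers. Let $\gamma=(c_1,c,c_2)\in\mathbb{T}$ with $\gamma\succ0$ and $\beta=(b_1,b,b_2)\in\mathbb{T}$ be such that $\max\{b-b_1,\,b_2-b\}\le\min\{c-c_1,\,c_2-c\}$. (i) If $\gamma=(-k,0,k)\in I_0$ with $k>0$, then the equation $|\alpha-\beta|_{\preceq}=\gamma$ (in the unknown $\alpha\in\mathbb{T}$) has a unique solution $\alpha_0=(b_2-k,\,b,\,b_1+k)$, and $\overline{\mathcal{B}_{\preceq}}(\beta,\gamma)=[\widehat{\beta},\alpha_0]_{\preceq}$, where $\widehat{\beta}=\min(N_{ull}(\beta))$. (ii) If $\gamma\notin I_0$, then $|\alpha-\beta|_{\preceq}=\gamma$ has two solutions $\alpha_1=(b_2-c_2,\,b-c,\,b_1-c_1)$ and $\alpha_2=(b_2+c_1,\,b+c,\,b_1+c_2)$, with $\alpha_1\prec\beta\prec\alpha_2$. In this case $$\overline{\mathcal{B}_{\preceq}}(\beta,\gamma)=\big([\alpha_1,\alpha_2]_{\preceq}\cup N_{ull}(\alpha_1)\big)\setminus(\alpha_1+I_0)=\big[\min(N_{ull}(\alpha_1)),\alpha_2\big]_{\preceq}\setminus(\alpha_1+I_0).$$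
   Context: Triangular fuzzy numbers: $\mathbb{T}=\{(a_1,a,a_2)\in\mathbb{R}^3: a_1\le a\le a_2\}$. Each $t\in\mathbb{R}$ is identified with the scalar $(t,t,t)\in\mathbb{T}$; in particular $0=(0,0,0)$. Operations: $(a_1,a,a_2)+(b_1,b,b_2)=(a_1+b_1,a+b,a_2+b_2)$; for $t\in\mathbb{R}$, $t(a_1,a,a_2)=(ta_1,ta,ta_2)$ if $t\ge0$ and $(ta_2,ta,ta_1)$ if $t<0$; $-\alpha=(-1)\alpha$, $\alpha-\beta=\alpha+(-1)\beta$. An order on $\mathbb{T}$ means a total order $\preceq$ (total, reflexive, antisymmetric, transitive); $\alpha\prec\beta$ means $\alpha\preceq\beta$ and $\alpha\ne\beta$. $I_0=\{(-t,0,t): t\in\mathbb{R},\ t>0\}$ and $\alpha_1+I_0=\{\alpha_1+\delta:\delta\in I_0\}$. The order has positive $0$-symmetric numbers if there is $\alpha\in I_0$ with $0\prec\alpha$. Compatibility with arithmetic operations: $\alpha\preceq\beta$ implies $\alpha+\gamma\preceq\beta+\gamma$ for all $\gamma\in\mathbb{T}$, and $t\alpha\preceq t\beta$ for all real $t\ge0$. WLT: for every $\alpha\in\mathbb{T}\setminus I_0$, exactly one of the following holds: $\alpha=0$, $0\prec\alpha$, $0\prec-\alpha$. Nullifying set of $\alpha=(a_1,a,a_2)$: $N_{ull}(\alpha)=\{\beta\in\mathbb{T}:\alpha-\beta\in I_0\cup\{0\}\}=\{(x,a,y)\in\mathbb{T}:x+y=a_1+a_2\}$. For such orders it has a $\preceq$-minimum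 $\min(N_{ull}(\alpha))$, equal to $(a_1+a_2-a,a,a)$ if $a_1+a_2\le2a$ and to $(a,a,a_1+a_2-a)$ if $a_1+a_2\ge2a$. $|\alpha|_{\preceq}=\max_{\preceq}\{\alpha,-\alpha\}$; $\overline{\mathcal{B}_{\preceq}}(\beta,\gamma)=\{\alpha\in\mathbb{T}:|\alpha-\beta|_{\preceq}\preceq\gamma\}$ (closed ball); $[\alpha,\beta]_{\preceq}=\{\gamma\in\mathbb{T}:\alpha\preceq\gamma\preceq\beta\}$. *)

theory Defs
  imports Complex_Main "HOL-Library.Product_Plus"
begin

text \<open>
  Triangular fuzzy numbers form a subset of \<open>real \<times> real \<times> real\<close>. Their addition and their zero are
  the componentwise ones of the product type. Negation and subtraction are \<^emph>\<open>not\<close> the componentwise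
  ones: multiplication by a negative scalar swaps the outer components, so that for instance
  \<open>tsub \<alpha> \<alpha>\<close> is in general nonzero.
\<close>

type_synonym triple = "real \<times> real \<times> real"

definition tfn :: "triple set" where
  "tfn = {(a1, a, a2). a1 \<le> a \<and> a \<le> a2}"

definition tscale :: "real \<Rightarrow> triple \<Rightarrow> triple" where
  "tscale t = (\<lambda>(a1, a, a2).
     if t \<ge> 0 then (t * a1, t * a, t * a2) else (t * a2, t * a, t * a1))"

definition tneg :: "triple \<Rightarrow> triple" where
  "tneg \<alpha> = tscale (-1) \<alpha>"

definition tsub :: "triple \<Rightarrow> triple \<Rightarrow> triple" where
  "tsub \<alpha> \<beta> = \<alpha> + tneg \<beta>"

definition sym0 :: "triple set" where
  "sym0 = {(- t, 0, t) |t. t > 0}"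

text \<open>
  An order on the triangular fuzzy numbers is a relation \<open>r\<close> with \<open>linear_order_on tfn r\<close>;
  its strict part is \<open>r - Id\<close>.
\<close>

definition compatible :: "triple rel \<Rightarrow> bool" where
  "compatible r \<longleftrightarrow> (\<forall>\<alpha>\<in>tfn. \<forall>\<beta>\<in>tfn. (\<alpha>, \<beta>) \<in> r \<longrightarrow>
     (\<forall>\<gamma>\<in>tfn. (\<alpha> + \<gamma>, \<beta> + \<gamma>) \<in> r) \<and> (\<forall>t\<ge>0. (tscale t \<alpha>, tscale t \<beta>) \<in> r))"

definition weak_trichotomy :: "triple rel \<Rightarrow> bool" where
  "weak_trichotomy r \<longleftrightarrow> (\<forall>\<alpha>\<in>tfn - sym0.
     (\<alpha> = 0 \<and> (0, \<alpha>) \<notin> r - Id \<and> (0, tneg \<alpha>) \<notin> r - Id) \<or>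
     (\<alpha> \<noteq> 0 \<and> (0, \<alpha>) \<in> r - Id \<and> (0, tneg \<alpha>) \<notin> r - Id) \<or>
     (\<alpha> \<noteq> 0 \<and> (0, \<alpha>) \<notin> r - Id \<and> (0, tneg \<alpha>) \<in> r - Id))"

definition has_positive_sym0 :: "triple rel \<Rightarrow> bool" where
  "has_positive_sym0 r \<longleftrightarrow> (\<exists>\<alpha>\<in>sym0. (0, \<alpha>) \<in> r - Id)"

definition min_wrt :: "'a rel \<Rightarrow> 'a set \<Rightarrow> 'a" where
  "min_wrt r S = (THE m. m \<in> S \<and> (\<forall>x\<in>S. (m, x) \<in> r))"

definition max_wrt :: "'a rel \<Rightarrow> 'a set \<Rightarrow> 'a" where
  "max_wrt r S = (THE m. m \<in> S \<and> (\<forall>x\<in>S. (x, m) \<in> r))"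

definition tabs :: "triple rel \<Rightarrow> triple \<Rightarrow> triple" where
  "tabs r \<alpha> = max_wrt r {\<alpha>, tneg \<alpha>}"

definition nullifying :: "triple \<Rightarrow> triple set" where
  "nullifying \<alpha> = {\<beta> \<in> tfn. tsub \<alpha> \<beta> \<in> sym0 \<union> {0}}"

definition closed_ball :: "triple rel \<Rightarrow> triple \<Rightarrow> triple \<Rightarrow> triple set" where
  "closed_ball r \<beta> \<gamma> = {\<alpha> \<in> tfn. (tabs r (tsub \<alpha> \<beta>), \<gamma>) \<in> r}"

definition interval :: "triple rel \<Rightarrow> triple \<Rightarrow> triple \<Rightarrow> triple set" where
  "interval r \<alpha> \<beta> = {\<gamma> \<in> tfn. (\<alpha>, \<gamma>) \<in> r \<and> (\<gamma>, \<beta>) \<in> r}"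

lemma nullifying_eq:
  assumes "(a1, a, a2) \<in> tfn"
  shows "nullifying (a1, a, a2) = {(x, a, y) |x y. (x, a, y) \<in> tfn \<and> x + y = a1 + a2}"
  using assms
  by (auto simp: nullifying_def tfn_def tsub_def tneg_def tscale_def sym0_def zero_prod_def)

end

theory Submission
  imports Defs
begin

text \<open>
  Write \<open>core (a1, a, a2) = (a, a1 + a2)\<close>; two fuzzy numbers have the same core iff they differ by a
  \<open>0\<close>-symmetric number. The weak law of trichotomy forces the sign of a number with nonzero core to
  depend on the core only: if \<open>\<alpha>\<close> is positive then \<open>- \<alpha>\<close> is negative, and subtracting a positive
  \<open>0\<close>-symmetric number from both cannot turn \<open>\<alpha>\<close> negative, since then \<open>- \<alpha>\<close> would be positive. Hence the
  order is lexicographic: first the cores are compared by a total group order on the plane, and ties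
  are broken by the upper end point. All sets in the theorem can then be described explicitly.
\<close>

section \<open>Coordinates on triples: core and upper end point\<close>

definition core :: "triple \<Rightarrow> real \<times> real" where
  "core = (\<lambda>(a1, a, a2). (a, a1 + a2))"

text \<open>The core fixes the sum of the outer components, so core and upper end point together
  determine the triple.\<close>

definition upper :: "triple \<Rightarrow> real" where
  "upper = (\<lambda>(a1, a, a2). a2)"

text \<open>\<open>tneg\<close> is not an additive inverse on triples, but swapping the outer
  components leaves no trace in their sum, so it becomes genuine negation in the plane.\<close>

lemma core_simps [simp]:
  "core 0 = 0" "core (\<alpha> + \<beta>) = core \<alpha> + core \<beta>" "core (tneg \<alpha>) = - core \<alpha>"
  "core (tsub \<alpha> \<beta>) = core \<alpha> - core \<beta>"
  by (cases \<alpha>; cases \<beta>; simp add: core_def tsub_def tneg_def tscale_def zero_prod_def)+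

lemma tfn_closed [simp, intro]:
  "0 \<in> tfn" "\<alpha> \<in> tfn \<Longrightarrow> \<beta> \<in> tfn \<Longrightarrow> \<alpha> + \<beta> \<in> tfn"
  "\<alpha> \<in> tfn \<Longrightarrow> tneg \<alpha> \<in> tfn" "\<alpha> \<in> tfn \<Longrightarrow> \<beta> \<in> tfn \<Longrightarrow> tsub \<alpha> \<beta> \<in> tfn"
  by (auto simp: tfn_def tsub_def tneg_def tscale_def zero_prod_def)

lemma tneg_tneg [simp]: "tneg (tneg \<alpha>) = \<alpha>"
  by (cases \<alpha>) (simp add: tneg_def tscale_def)

lemma core_eq_0_iff: "\<alpha> \<in> tfn \<Longrightarrow> core \<alpha> = 0 \<longleftrightarrow> \<alpha> \<in> sym0 \<union> {0}"
  by (cases \<alpha>) (auto simp: tfn_def core_def sym0_def zero_prod_def)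

lemma core_eq_iff:
  assumes "upper \<alpha> \<le> upper \<beta>"
  shows "core \<alpha> = core \<beta> \<longleftrightarrow> (\<exists>t\<ge>0. \<beta> = \<alpha> + (- t, 0, t))"
proof
  assume "core \<alpha> = core \<beta>"
  then have "\<beta> = \<alpha> + (- (upper \<beta> - upper \<alpha>), 0, upper \<beta> - upper \<alpha>)"
    by (cases \<alpha>; cases \<beta>) (simp add: core_def upper_def)
  with assms show "\<exists>t\<ge>0. \<beta> = \<alpha> + (- t, 0, t)"
    by (metis diff_ge_0_iff_ge)
qed (cases \<alpha>, auto simp: core_def)

text \<open>Puts the set removed in the theorem into core and upper coordinates: moving along
  \<open>sym0\<close> keeps the core and strictly raises the upper end point.\<close>

lemma translate_sym0:
  "(\<lambda>\<delta>. \<alpha> + \<delta>) ` sym0 = {\<beta>. core \<beta> = core \<alpha> \<and> upper \<alpha> < upper \<beta>}"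
proof (intro equalityI subsetI)
  fix \<beta> assume "\<beta> \<in> {\<beta>. core \<beta> = core \<alpha> \<and> upper \<alpha> < upper \<beta>}"
  then obtain t where "t \<ge> 0" "\<beta> = \<alpha> + (- t, 0, t)" "upper \<alpha> < upper \<beta>"
    using core_eq_iff[of \<alpha> \<beta>] by auto
  moreover from this have "t > 0"
    by (cases \<alpha>) (simp add: upper_def)
  ultimately show "\<beta> \<in> (\<lambda>\<delta>. \<alpha> + \<delta>) ` sym0"
    by (auto simp: sym0_def)
qed (cases \<alpha>, auto simp: core_def upper_def sym0_def)

lemma nullifying_core:
  assumes "\<alpha> \<in> tfn"
  shows "nullifying \<alpha> = {\<beta> \<in> tfn. core \<beta> = core \<alpha>}"
proof -
  have "tsub \<alpha> \<beta> \<in> sym0 \<union> {0} \<longleftrightarrow> core \<beta> = core \<alpha>" if "\<beta> \<in> tfn" for \<beta>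
    using that assms core_eq_0_iff[of "tsub \<alpha> \<beta>"] by auto
  then show ?thesis
    unfolding nullifying_def by blast
qed

section \<open>Consequences of the order axioms\<close>

locale tfn_order =
  fixes r :: "triple rel"
  assumes linear: "linear_order_on tfn r"
    and compat: "compatible r"
    and trichotomy: "weak_trichotomy r"
    and positive_sym0: "has_positive_sym0 r"
begin

lemma le_in_tfn: "(\<alpha>, \<beta>) \<in> r \<Longrightarrow> \<alpha> \<in> tfn \<and> \<beta> \<in> tfn"
  using linear by (auto simp: order_on_defs refl_on_def)

lemma le_refl: "\<alpha> \<in> tfn \<Longrightarrow> (\<alpha>, \<alpha>) \<in> r"
  using linear by (auto simp: order_on_defs refl_on_def)

lemma le_total: "\<alpha> \<in> tfn \<Longrightarrow> \<beta> \<in> tfn \<Longrightarrow> (\<alpha>, \<beta>) \<in> r \<or> (\<beta>, \<alpha>) \<in> r"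
  using linear le_refl by (cases "\<alpha> = \<beta>") (auto simp: order_on_defs total_on_def)

lemma le_antisym: "(\<alpha>, \<beta>) \<in> r \<Longrightarrow> (\<beta>, \<alpha>) \<in> r \<Longrightarrow> \<alpha> = \<beta>"
  using linear unfolding order_on_defs antisym_def by blast

lemma le_trans: "(\<alpha>, \<beta>) \<in> r \<Longrightarrow> (\<beta>, \<gamma>) \<in> r \<Longrightarrow> (\<alpha>, \<gamma>) \<in> r"
  using linear unfolding order_on_defs trans_def by blast

text \<open>Without inverses, cancellation comes from totality: were
  \<open>\<alpha> \<le> \<beta>\<close> false, compatibility would give the reverse inequality
  between the sums, hence equal sums, and componentwise addition is cancellative.\<close>

lemma add_le_cancel:
  assumes "\<alpha> \<in> tfn" "\<beta> \<in> tfn" "\<gamma> \<in> tfn"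
  shows "(\<alpha> + \<gamma>, \<beta> + \<gamma>) \<in> r \<longleftrightarrow> (\<alpha>, \<beta>) \<in> r"
proof
  assume *: "(\<alpha> + \<gamma>, \<beta> + \<gamma>) \<in> r"
  show "(\<alpha>, \<beta>) \<in> r"
  proof (rule ccontr)
    assume not_le: "(\<alpha>, \<beta>) \<notin> r"
    then have "(\<beta> + \<gamma>, \<alpha> + \<gamma>) \<in> r"
      using le_total assms compat unfolding compatible_def by blast
    with * have "\<alpha> + \<gamma> = \<beta> + \<gamma>"
      by (rule le_antisym)
    then show False
      using not_le le_refl assms by simp
  qed
qed (use assms compat in \<open>auto simp: compatible_def\<close>)

text \<open>\<open>sym0\<close> is a single ray, so rescaling its one known positive element reaches
  every other; the factor 0 covers \<open>t = 0\<close>.\<close>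

lemma sym0_positive:
  assumes "t \<ge> 0"
  shows "(0, (- t, 0, t)) \<in> r"
proof -
  obtain s where s: "s > 0" "(0, (- s, 0, s)) \<in> r"
    using positive_sym0 by (auto simp: has_positive_sym0_def sym0_def)
  then have "(tscale (t / s) 0, tscale (t / s) (- s, 0, s)) \<in> r"
    using assms compat le_in_tfn unfolding compatible_def
    by (metis divide_nonneg_pos)
  then show ?thesis
    using s assms by (simp add: tscale_def zero_prod_def)
qed

lemma le_if_same_core:
  assumes "\<alpha> \<in> tfn" "\<beta> \<in> tfn" "core \<alpha> = core \<beta>" "upper \<alpha> \<le> upper \<beta>"
  shows "(\<alpha>, \<beta>) \<in> r"
proof -
  obtain t where t: "t \<ge> 0" "\<beta> = \<alpha> + (- t, 0, t)"
    using core_eq_iff assms(3,4) by blast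
  have "(0 + \<alpha>, (- t, 0, t) + \<alpha>) \<in> r"
    using add_le_cancel[of 0 "(- t, 0, t)" \<alpha>] sym0_positive[OF t(1)] le_in_tfn assms(1) by blast
  then show ?thesis
    using t(2) by (simp add: add.commute)
qed

lemma le_iff_same_core:
  assumes "\<alpha> \<in> tfn" "\<beta> \<in> tfn" "core \<alpha> = core \<beta>"
  shows "(\<alpha>, \<beta>) \<in> r \<longleftrightarrow> upper \<alpha> \<le> upper \<beta>"
  using assms le_if_same_core[of \<alpha> \<beta>] le_if_same_core[of \<beta> \<alpha>] le_antisym[of \<alpha> \<beta>]
  by (metis linorder_le_cases order_refl)

text \<open>A number with nonzero core is neither \<open>0\<close> nor in \<open>sym0\<close>, so
  the weak law applies; as \<open>tneg \<alpha>\<close> is nonzero too, its strict inequalities may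
  be read as weak ones.\<close>

lemma neg_le_0_iff:
  assumes "\<alpha> \<in> tfn" "core \<alpha> \<noteq> 0"
  shows "(0, tneg \<alpha>) \<in> r \<longleftrightarrow> (0, \<alpha>) \<notin> r"
proof -
  have "\<alpha> \<in> tfn - sym0" "\<alpha> \<noteq> 0" "tneg \<alpha> \<noteq> 0"
    using assms core_eq_0_iff[of \<alpha>] core_eq_0_iff[of "tneg \<alpha>"] by auto
  then show ?thesis
    using trichotomy unfolding weak_trichotomy_def by (smt (verit) DiffE DiffI pair_in_Id_conv)
qed

lemma positive_if_same_core:
  assumes "\<alpha> \<in> tfn" "\<beta> \<in> tfn" "core \<alpha> = core \<beta>" "core \<alpha> \<noteq> 0" "(0, \<alpha>) \<in> r"
  shows "(0, \<beta>) \<in> r"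
proof (cases "upper \<alpha> \<le> upper \<beta>")
  case True
  then show ?thesis
    using le_if_same_core le_trans assms by blast
next
  case False
  \<comment> \<open>With equal sums, the smaller upper end point goes with the larger lower one, and
    \<open>tneg\<close> turns lower end points into negated upper ones. So were
    \<open>\<beta>\<close> not positive, \<open>tneg \<beta>\<close> and then
    \<open>tneg \<alpha>\<close> would be.\<close>
  then have "upper (tneg \<beta>) \<le> upper (tneg \<alpha>)"
    using assms(3) by (cases \<alpha>; cases \<beta>) (simp add: core_def upper_def tneg_def tscale_def)
  then have "(tneg \<beta>, tneg \<alpha>) \<in> r"
    using le_if_same_core assms by simp
  then show ?thesis
    using neg_le_0_iff assms le_trans by metis
qed

section \<open>The positive cone of the induced group order on the plane\<close>

definition pos :: "real \<times> real \<Rightarrow> bool" where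
  "pos u \<longleftrightarrow> u \<noteq> 0 \<and> (\<exists>\<alpha>\<in>tfn. core \<alpha> = u \<and> (0, \<alpha>) \<in> r)"

lemma pos_core_iff: "\<alpha> \<in> tfn \<Longrightarrow> pos (core \<alpha>) \<longleftrightarrow> core \<alpha> \<noteq> 0 \<and> (0, \<alpha>) \<in> r"
  using positive_if_same_core unfolding pos_def by metis

lemma core_surj: obtains \<alpha> where "\<alpha> \<in> tfn" "core \<alpha> = u"
proof -
  obtain x y where u: "u = (x, y)"
    by fastforce
  \<comment> \<open>Widening a triple by \<open>w\<close> on both sides keeps its core;
    \<open>w \<ge> 0\<close> and \<open>w \<ge> 2 * x - y\<close> put the components in
    order.\<close>
  let ?w = "\<bar>y\<bar> + 2 * \<bar>x\<bar>"
  have "(x - ?w, x, y - x + ?w) \<in> tfn" "core (x - ?w, x, y - x + ?w) = u"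
    by (auto simp: tfn_def core_def u)
  then show thesis
    by (rule that)
qed

lemma pos_minus: "u \<noteq> 0 \<Longrightarrow> pos (- u) \<longleftrightarrow> \<not> pos u"
  using core_surj[of u] neg_le_0_iff pos_core_iff
  by (metis core_simps(3) neg_equal_0_iff_equal tfn_closed(3))

lemma not_pos_0 [simp]: "\<not> pos 0"
  by (simp add: pos_def)

lemma pos_add:
  assumes "pos u" "pos v"
  shows "pos (u + v)"
proof -
  obtain \<alpha> \<beta> where ab: "\<alpha> \<in> tfn" "core \<alpha> = u" "(0, \<alpha>) \<in> r" "\<beta> \<in> tfn" "core \<beta> = v" "(0, \<beta>) \<in> r"
    using assms unfolding pos_def by blast
  then have "(0 + \<beta>, \<alpha> + \<beta>) \<in> r"
    using add_le_cancel[of 0 \<alpha> \<beta>] by blast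
  then have "(0, \<alpha> + \<beta>) \<in> r"
    using ab(6) le_trans by simp
  \<comment> \<open>Otherwise \<open>v = - u\<close>, and \<open>u\<close> and \<open>- u\<close>
    cannot both be positive.\<close>
  moreover have "u + v \<noteq> 0"
    using assms pos_minus by (metis add.commute minus_unique not_pos_0)
  ultimately show ?thesis
    using ab unfolding pos_def by (metis core_simps(2) tfn_closed(2))
qed

lemma less_if_pos:
  assumes "\<alpha> \<in> tfn" "\<beta> \<in> tfn" "pos (core \<beta> - core \<alpha>)"
  shows "(\<alpha>, \<beta>) \<in> r \<and> (\<beta>, \<alpha>) \<notin> r"
proof -
  have "(\<beta>, \<alpha>) \<notin> r"
  proof
    assume "(\<beta>, \<alpha>) \<in> r"
    then have "(\<beta> + tneg \<beta>, \<alpha> + tneg \<beta>) \<in> r"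
      using assms add_le_cancel by simp
    \<comment> \<open>\<open>\<beta> + tneg \<beta>\<close> need not vanish, but it is
      \<open>(- t, 0, t)\<close> with \<open>t\<close> the full width of \<open>\<beta>\<close>,
      hence nonnegative. This is how the failing inverse law is bypassed.\<close>
    moreover have "(0, \<beta> + tneg \<beta>) \<in> r"
      using sym0_positive[of "upper \<beta> - fst \<beta>"] assms(2)
      by (cases \<beta>) (simp add: tfn_def upper_def tneg_def tscale_def)
    ultimately have "(0, tsub \<alpha> \<beta>) \<in> r"
      using le_trans unfolding tsub_def by blast
    moreover have "core (tsub \<alpha> \<beta>) \<noteq> 0"
      using assms(3) by auto
    ultimately have "pos (core \<alpha> - core \<beta>)"
      using pos_core_iff[of "tsub \<alpha> \<beta>"] assms by simp
    then show False
      using assms(3) pos_minus by (metis minus_diff_eq not_pos_0)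
  qed
  then show ?thesis
    using le_total assms by blast
qed

text \<open>The lexicographic description. If the core difference is neither zero nor positive, its
  negative is positive, and \<open>less_if_pos\<close> with the arguments exchanged refutes the
  inequality.\<close>

lemma le_iff:
  assumes "\<alpha> \<in> tfn" "\<beta> \<in> tfn"
  shows "(\<alpha>, \<beta>) \<in> r \<longleftrightarrow> pos (core \<beta> - core \<alpha>) \<or> core \<beta> - core \<alpha> = 0 \<and> upper \<alpha> \<le> upper \<beta>"
proof (cases "core \<beta> - core \<alpha> = 0")
  case True
  then show ?thesis
    using le_iff_same_core assms by simp
next
  case False
  then show ?thesis
    using less_if_pos[OF assms] less_if_pos[OF assms(2,1)] pos_minus[OF False] by auto
qed

section \<open>Absolute values and minima of nullifying sets\<close>

lemma tabs_cases:
  assumes "\<delta> \<in> tfn"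
  shows "tabs r \<delta> \<in> {\<delta>, tneg \<delta>} \<and> (\<delta>, tabs r \<delta>) \<in> r \<and> (tneg \<delta>, tabs r \<delta>) \<in> r"
proof -
  obtain m where m: "m \<in> {\<delta>, tneg \<delta>}" "(\<delta>, m) \<in> r" "(tneg \<delta>, m) \<in> r"
    using le_total[of \<delta> "tneg \<delta>"] le_refl assms by blast
  have "tabs r \<delta> = m"
    unfolding tabs_def max_wrt_def
  proof (rule the_equality)
    show "m' = m" if "m' \<in> {\<delta>, tneg \<delta>} \<and> (\<forall>x\<in>{\<delta>, tneg \<delta>}. (x, m') \<in> r)" for m'
      using that m by (intro le_antisym) blast+
  qed (use m in blast)
  then show ?thesis
    using m by blast
qed

lemma tabs_le_iff:
  assumes "\<delta> \<in> tfn"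
  shows "(tabs r \<delta>, \<gamma>) \<in> r \<longleftrightarrow> (\<delta>, \<gamma>) \<in> r \<and> (tneg \<delta>, \<gamma>) \<in> r"
proof
  assume "(tabs r \<delta>, \<gamma>) \<in> r"
  then show "(\<delta>, \<gamma>) \<in> r \<and> (tneg \<delta>, \<gamma>) \<in> r"
    using tabs_cases[OF assms] le_trans by blast
qed (use tabs_cases[OF assms] in auto)

text \<open>A nonnegative \<open>\<gamma>\<close> dominates \<open>tneg \<gamma>\<close>, so it is
  the maximum of \<open>\<delta>\<close> and \<open>tneg \<delta>\<close> as soon as it is one of
  them. Core zero is treated apart: there \<open>tneg\<close> fixes \<open>\<gamma>\<close>.\<close>

lemma tabs_eq_iff:
  assumes "\<delta> \<in> tfn" "(0, \<gamma>) \<in> r"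
  shows "tabs r \<delta> = \<gamma> \<longleftrightarrow> \<delta> = \<gamma> \<or> tneg \<delta> = \<gamma>"
proof -
  have g: "\<gamma> \<in> tfn"
    using assms(2) le_in_tfn by blast
  have le: "(tneg \<gamma>, \<gamma>) \<in> r"
  proof (cases "core \<gamma> = 0")
    case True
    then have "tneg \<gamma> = \<gamma>"
      using g core_eq_0_iff by (auto simp: sym0_def tneg_def tscale_def zero_prod_def)
    then show ?thesis
      using le_refl g by simp
  next
    case False
    then have "(tneg \<gamma>, 0) \<in> r"
      using neg_le_0_iff assms(2) le_total g by blast
    then show ?thesis
      using assms(2) le_trans by blast
  qed
  show ?thesis
    using tabs_cases[OF assms(1)] le le_antisym by (metis empty_iff insert_iff tneg_tneg)
qed

text \<open>The nullifying set is a whole fibre of \<open>core\<close>. Starting an interval at its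
  minimum therefore removes the tie-break, leaving a condition on cores alone.\<close>

lemma min_nullifying_le_iff:
  assumes "\<alpha> \<in> tfn" "\<beta> \<in> tfn"
  shows "(min_wrt r (nullifying \<alpha>), \<beta>) \<in> r \<longleftrightarrow>
    pos (core \<beta> - core \<alpha>) \<or> core \<beta> - core \<alpha> = 0"
proof -
  obtain a1 a a2 where a: "\<alpha> = (a1, a, a2)"
    using prod_cases3 by blast
  \<comment> \<open>An element \<open>(x, a, y)\<close> of the fibre has \<open>y \<ge> a\<close>
    and, since \<open>x \<le> a\<close>, also \<open>y \<ge> a1 + a2 - a\<close>; \<open>m\<close>
    attains the larger of these bounds.\<close>
  define m where "m = (if a1 + a2 \<le> 2 * a then (a1 + a2 - a, a, a) else (a, a, a1 + a2 - a))"
  have m: "m \<in> tfn" "core m = core \<alpha>"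
    by (auto simp: m_def a tfn_def core_def)
  have upper_m: "upper m \<le> upper x" if "x \<in> tfn" "core x = core \<alpha>" for x
    using that by (cases x) (auto simp: m_def a tfn_def core_def upper_def)
  have "min_wrt r (nullifying \<alpha>) = m"
    unfolding min_wrt_def
  proof (rule the_equality)
    show *: "m \<in> nullifying \<alpha> \<and> (\<forall>x\<in>nullifying \<alpha>. (m, x) \<in> r)"
      using m upper_m by (auto simp: nullifying_core assms le_iff)
    show "m' = m" if "m' \<in> nullifying \<alpha> \<and> (\<forall>x\<in>nullifying \<alpha>. (m', x) \<in> r)" for m'
      using that * le_antisym by blast
  qed
  then show ?thesis
    using m upper_m[of \<beta>] assms by (auto simp: le_iff)
qed

section \<open>Equations and closed balls\<close>

lemma solutions_sym0:
  assumes "k > 0" "(b1, b, b2) \<in> tfn" "b - b1 \<le> k" "b2 - b \<le> k"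
  shows "{\<alpha> \<in> tfn. tabs r (tsub \<alpha> (b1, b, b2)) = (- k, 0, k)} = {(b2 - k, b, b1 + k)}"
proof -
  have "(0, (- k, 0, k)) \<in> r"
    using sym0_positive assms(1) by simp
  \<comment> \<open>Since \<open>(- k, 0, k)\<close> is its own negative, the two candidate
    equations coincide; hence uniqueness.\<close>
  moreover have "tsub x (b1, b, b2) = (- k, 0, k) \<longleftrightarrow> x = (b2 - k, b, b1 + k)"
    "tneg (tsub x (b1, b, b2)) = (- k, 0, k) \<longleftrightarrow> x = (b2 - k, b, b1 + k)" for x
    by (cases x; auto simp: tsub_def tneg_def tscale_def)+
  ultimately have "tabs r (tsub x (b1, b, b2)) = (- k, 0, k) \<longleftrightarrow> x = (b2 - k, b, b1 + k)"
    if "x \<in> tfn" for x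
    using that assms(2) by (simp add: tabs_eq_iff)
  moreover have "(b2 - k, b, b1 + k) \<in> tfn"
    using assms by (simp add: tfn_def)
  ultimately show ?thesis
    by blast
qed

lemma closed_ball_sym0:
  assumes "k > 0" "(b1, b, b2) \<in> tfn" "b - b1 \<le> k" "b2 - b \<le> k"
  shows "closed_ball r (b1, b, b2) (- k, 0, k) =
    interval r (min_wrt r (nullifying (b1, b, b2))) (b2 - k, b, b1 + k)"
proof -
  let ?\<beta> = "(b1, b, b2)" and ?\<gamma> = "(- k, 0, k)" and ?\<alpha> = "(b2 - k, b, b1 + k)"
  have tfn: "?\<gamma> \<in> tfn" "?\<alpha> \<in> tfn"
    using assms by (auto simp: tfn_def)
  have core: "core ?\<gamma> = 0" "core ?\<alpha> = core ?\<beta>"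
    by (auto simp: core_def zero_prod_def)
  have "x \<in> closed_ball r ?\<beta> ?\<gamma> \<longleftrightarrow> x \<in> interval r (min_wrt r (nullifying ?\<beta>)) ?\<alpha>"
    if x: "x \<in> tfn" for x
  proof (cases "core x - core ?\<beta> = 0")
    case True
    \<comment> \<open>The difference has core zero, so \<open>tneg\<close> fixes it and both halves
      of the ball condition give the same bound.\<close>
    then have "upper (tsub x ?\<beta>) \<le> k \<longleftrightarrow> upper x \<le> upper ?\<alpha>"
      "upper (tneg (tsub x ?\<beta>)) \<le> k \<longleftrightarrow> upper x \<le> upper ?\<alpha>"
      by (cases x; auto simp: core_def upper_def tsub_def tneg_def tscale_def zero_prod_def)+
    moreover have "upper ?\<gamma> = k"
      by (simp add: upper_def)
    ultimately show ?thesis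
      using True x tfn assms(2) core
      by (simp add: closed_ball_def interval_def tabs_le_iff min_nullifying_le_iff le_iff)
  next
    \<comment> \<open>Both sets are empty here: each would require the nonzero core difference and
      its negative to be positive.\<close>
    case False
    then show ?thesis
      using x tfn assms(2) core pos_minus[OF False]
      by (auto simp: closed_ball_def interval_def tabs_le_iff min_nullifying_le_iff le_iff)
  qed
  then show ?thesis
    by (auto simp: closed_ball_def interval_def)
qed

text \<open>Ball and interval can differ only on the fibre of \<open>\<alpha>1\<close>. There
  negation reverses the tie-break: the ball keeps upper end points at most that of
  \<open>\<alpha>1\<close>, the interval those at least that. Adding the whole fibre and removing
  the translate of \<open>sym0\<close> corrects this.\<close>

lemma closed_ball_non_sym0:
  assumes "pos (core \<gamma>)" "\<gamma> \<in> tfn" "\<beta> \<in> tfn" "\<alpha>1 \<in> tfn" "\<alpha>2 \<in> tfn"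
    and eq: "tsub \<alpha>1 \<beta> = tneg \<gamma>" "tsub \<alpha>2 \<beta> = \<gamma>"
  shows "closed_ball r \<beta> \<gamma> = (interval r \<alpha>1 \<alpha>2 \<union> nullifying \<alpha>1) - (\<lambda>\<delta>. \<alpha>1 + \<delta>) ` sym0"
    and "closed_ball r \<beta> \<gamma> =
      interval r (min_wrt r (nullifying \<alpha>1)) \<alpha>2 - (\<lambda>\<delta>. \<alpha>1 + \<delta>) ` sym0"
proof -
  define g where "g = core \<gamma>"
  have g: "pos g" "pos (g + g)" "g \<noteq> 0" "g + g \<noteq> 0"
    using assms(1) pos_add not_pos_0 unfolding g_def by metis+
  have core: "core \<alpha>1 = core \<beta> - g" "core \<alpha>2 = core \<beta> + g"
    using core_simps(4)[of \<alpha>1 \<beta>] core_simps(4)[of \<alpha>2 \<beta>] by (auto simp: eq g_def algebra_simps)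
  have "(x \<in> closed_ball r \<beta> \<gamma> \<longleftrightarrow>
      x \<in> (interval r \<alpha>1 \<alpha>2 \<union> nullifying \<alpha>1) - (\<lambda>\<delta>. \<alpha>1 + \<delta>) ` sym0) \<and>
    (x \<in> closed_ball r \<beta> \<gamma> \<longleftrightarrow>
      x \<in> interval r (min_wrt r (nullifying \<alpha>1)) \<alpha>2 - (\<lambda>\<delta>. \<alpha>1 + \<delta>) ` sym0)"
    if x: "x \<in> tfn" for x
  proof -
    define d where "d = core x - core \<beta>"
    have x_core: "core x = core \<beta> + d"
      by (simp add: d_def)
    have core_iff: "core x = core \<alpha>1 \<longleftrightarrow> g + d = 0"
      unfolding core(1) x_core diff_conv_add_uminus add_left_cancel add_eq_0_iff ..
    have up2: "upper (tsub x \<beta>) \<le> upper \<gamma> \<longleftrightarrow> upper x \<le> upper \<alpha>2"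
      unfolding eq(2)[symmetric]
      by (cases x; cases \<beta>; cases \<alpha>2) (simp add: upper_def tsub_def tneg_def tscale_def)
    \<comment> \<open>The left side says that the lower end point of \<open>x\<close> is at least
      that of \<open>\<alpha>1\<close>; equal sums turn this into an upper bound on the upper end
      point.\<close>
    have up1: "upper (tneg (tsub x \<beta>)) \<le> upper \<gamma> \<longleftrightarrow> upper x \<le> upper \<alpha>1" if "g + d = 0"
    proof -
      have "core x = core \<alpha>1"
        using that core_iff by blast
      moreover have "\<gamma> = tneg (tsub \<alpha>1 \<beta>)"
        by (simp add: eq)
      ultimately show ?thesis
        by (cases x; cases \<beta>; cases \<alpha>1)
          (auto simp: core_def upper_def tsub_def tneg_def tscale_def)
    qed
    have ball: "x \<in> closed_ball r \<beta> \<gamma> \<longleftrightarrow>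
      (pos (g - d) \<or> g - d = 0 \<and> upper x \<le> upper \<alpha>2) \<and>
      (pos (g + d) \<or> g + d = 0 \<and> upper x \<le> upper \<alpha>1)"
      using x assms(2,3) up1 up2
      by (auto simp: closed_ball_def tabs_le_iff le_iff x_core simp flip: g_def)
    have low: "(\<alpha>1, x) \<in> r \<longleftrightarrow> pos (g + d) \<or> g + d = 0 \<and> upper \<alpha>1 \<le> upper x"
      using x assms(4) by (simp add: le_iff core x_core add.commute)
    have up: "(x, \<alpha>2) \<in> r \<longleftrightarrow> pos (g - d) \<or> g - d = 0 \<and> upper x \<le> upper \<alpha>2"
      using x assms(5) by (simp add: le_iff core x_core)
    have min: "(min_wrt r (nullifying \<alpha>1), x) \<in> r \<longleftrightarrow> pos (g + d) \<or> g + d = 0"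
      using x assms(4) by (simp add: min_nullifying_le_iff core x_core add.commute)
    have null: "x \<in> nullifying \<alpha>1 \<longleftrightarrow> g + d = 0"
      using x assms(4)
      by (simp add: nullifying_core core_iff)
    have trans: "x \<in> (\<lambda>\<delta>. \<alpha>1 + \<delta>) ` sym0 \<longleftrightarrow> g + d = 0 \<and> upper \<alpha>1 < upper x"
      by (simp add: translate_sym0 core_iff)
    \<comment> \<open>On the fibre of \<open>\<alpha>1\<close>, \<open>g - d\<close> equals
      \<open>g + g\<close>, so the bound by \<open>\<alpha>2\<close> holds automatically.\<close>
    have pos: "pos (g - d)" if "g + d = 0"
      using that g(2) by (metis add.inverse_inverse diff_conv_add_uminus minus_unique)
    show ?thesis
      using x pos by (auto simp: ball interval_def low up min null trans)
  qed
  then show "closed_ball r \<beta> \<gamma> = (interval r \<alpha>1 \<alpha>2 \<union> nullifying \<alpha>1) - (\<lambda>\<delta>. \<alpha>1 + \<delta>) ` sym0"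
    and "closed_ball r \<beta> \<gamma> =
      interval r (min_wrt r (nullifying \<alpha>1)) \<alpha>2 - (\<lambda>\<delta>. \<alpha>1 + \<delta>) ` sym0"
    by (auto simp: closed_ball_def interval_def nullifying_def)
qed

end

theorem theorem31:
  fixes r :: "triple rel" and \<beta> \<gamma> :: triple and b1 b b2 c1 c c2 :: real
  assumes "linear_order_on tfn r"
    and "compatible r"
    and "weak_trichotomy r"
    and "has_positive_sym0 r"
    and "\<gamma> = (c1, c, c2)" and "\<gamma> \<in> tfn" and "(0, \<gamma>) \<in> r - Id"
    and "\<beta> = (b1, b, b2)" and "\<beta> \<in> tfn"
    and "max (b - b1) (b2 - b) \<le> min (c - c1) (c2 - c)"
  shows
    "(\<forall>k>0. \<gamma> = (- k, 0, k) \<longrightarrow>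
        (let \<alpha>0 = (b2 - k, b, b1 + k) in
          {\<alpha> \<in> tfn. tabs r (tsub \<alpha> \<beta>) = \<gamma>} = {\<alpha>0} \<and>
          closed_ball r \<beta> \<gamma> = interval r (min_wrt r (nullifying \<beta>)) \<alpha>0)) \<and>
     (\<gamma> \<notin> sym0 \<longrightarrow>
        (let \<alpha>1 = (b2 - c2, b - c, b1 - c1); \<alpha>2 = (b2 + c1, b + c, b1 + c2) in
          {\<alpha> \<in> tfn. tabs r (tsub \<alpha> \<beta>) = \<gamma>} = {\<alpha>1, \<alpha>2} \<and> \<alpha>1 \<noteq> \<alpha>2 \<and>
          (\<alpha>1, \<beta>) \<in> r - Id \<and> (\<beta>, \<alpha>2) \<in> r - Id \<and>
          closed_ball r \<beta> \<gamma> =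
            (interval r \<alpha>1 \<alpha>2 \<union> nullifying \<alpha>1) - (\<lambda>\<delta>. \<alpha>1 + \<delta>) ` sym0 \<and>
          closed_ball r \<beta> \<gamma> =
            interval r (min_wrt r (nullifying \<alpha>1)) \<alpha>2 - (\<lambda>\<delta>. \<alpha>1 + \<delta>) ` sym0))"
proof -
  interpret tfn_order r
    using assms(1-4) by unfold_locales
  \<comment> \<open>These four inequalities say exactly that the components of
    \<open>\<alpha>1\<close> and \<open>\<alpha>2\<close> are in order.\<close>
  have width: "b - b1 \<le> c - c1" "b - b1 \<le> c2 - c" "b2 - b \<le> c - c1" "b2 - b \<le> c2 - c"
    using assms(10) by auto
  have "{\<alpha> \<in> tfn. tabs r (tsub \<alpha> \<beta>) = \<gamma>} = {(b2 - k, b, b1 + k)} \<and>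
      closed_ball r \<beta> \<gamma> = interval r (min_wrt r (nullifying \<beta>)) (b2 - k, b, b1 + k)"
    if "k > 0" "\<gamma> = (- k, 0, k)" for k
    using that solutions_sym0[of k b1 b b2] closed_ball_sym0[of k b1 b b2] width assms(5,8,9)
    by simp
  moreover have "{\<alpha> \<in> tfn. tabs r (tsub \<alpha> \<beta>) = \<gamma>} = {\<alpha>1, \<alpha>2} \<and> \<alpha>1 \<noteq> \<alpha>2 \<and>
      (\<alpha>1, \<beta>) \<in> r - Id \<and> (\<beta>, \<alpha>2) \<in> r - Id \<and>
      closed_ball r \<beta> \<gamma> = (interval r \<alpha>1 \<alpha>2 \<union> nullifying \<alpha>1) - (\<lambda>\<delta>. \<alpha>1 + \<delta>) ` sym0 \<and>
      closed_ball r \<beta> \<gamma> =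
        interval r (min_wrt r (nullifying \<alpha>1)) \<alpha>2 - (\<lambda>\<delta>. \<alpha>1 + \<delta>) ` sym0"
    if "\<gamma> \<notin> sym0" and \<alpha>1: "\<alpha>1 = (b2 - c2, b - c, b1 - c1)"
      and \<alpha>2: "\<alpha>2 = (b2 + c1, b + c, b1 + c2)" for \<alpha>1 \<alpha>2
  proof -
    have tfn: "\<alpha>1 \<in> tfn" "\<alpha>2 \<in> tfn"
      using width by (auto simp: \<alpha>1 \<alpha>2 tfn_def)
    \<comment> \<open>Subtraction takes \<open>b2\<close> from the first component and
      \<open>b1\<close> from the last, which explains the crossed end points in the
      solutions.\<close>
    have eq: "tsub \<alpha>1 \<beta> = tneg \<gamma>" "tsub \<alpha>2 \<beta> = \<gamma>"
      by (auto simp: \<alpha>1 \<alpha>2 assms(5,8) tsub_def tneg_def tscale_def)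
    \<comment> \<open>A fuzzy number that is nonzero and outside \<open>sym0\<close> has nonzero
      core, so the positivity of \<open>\<gamma>\<close> passes to its core.\<close>
    have pos: "pos (core \<gamma>)"
      using assms(6,7) that(1) core_eq_0_iff pos_core_iff by auto
    have core: "core \<alpha>1 = core \<beta> - core \<gamma>" "core \<alpha>2 = core \<beta> + core \<gamma>"
      by (auto simp: \<alpha>1 \<alpha>2 assms(5,8) core_def)
    have less: "(\<alpha>1, \<beta>) \<in> r" "(\<beta>, \<alpha>1) \<notin> r" "(\<beta>, \<alpha>2) \<in> r" "(\<alpha>2, \<beta>) \<notin> r"
      using less_if_pos[of \<alpha>1 \<beta>] less_if_pos[of \<beta> \<alpha>2] tfn assms(9) pos core by auto
    have "{\<alpha> \<in> tfn. tabs r (tsub \<alpha> \<beta>) = \<gamma>} = {\<alpha>1, \<alpha>2}"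
    proof -
      have "tsub x \<beta> = \<gamma> \<longleftrightarrow> x = \<alpha>2" "tneg (tsub x \<beta>) = \<gamma> \<longleftrightarrow> x = \<alpha>1" for x
        by (cases x; auto simp: \<alpha>1 \<alpha>2 assms(5,8) tsub_def tneg_def tscale_def)+
      then have "tabs r (tsub x \<beta>) = \<gamma> \<longleftrightarrow> x = \<alpha>2 \<or> x = \<alpha>1" if "x \<in> tfn" for x
        using that assms(7,9) by (simp add: tabs_eq_iff)
      then show ?thesis
        using tfn by blast
    qed
    then show ?thesis
      using less closed_ball_non_sym0[OF pos assms(6,9) tfn eq] by auto
  qed
  ultimately show ?thesis
    unfolding Let_def by blast
qed

end
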